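(* Let $n,p\ge 1$, let $A\in GL_n(\mathbb{C})$, and let $Q(X)=X^p-c_{p-1}X^{p-1}-\ldots-c_1X-c_0\in\mathbb{C}[X]$ with $c_0\ne 0$ be such that $Q(A)=0$. Let $\lambda_1,\ldots,\lambda_m$ be the distinct roots of $Q$, with multiplicities $n_1,\ldots,n_m$ (so $n_1+\ldots+n_m=p$). Let $f_1(z),\ldots,f_p(z)$ be an enumeration of the $p$ functions $g_j(z)\lambda_i^{z-j}$ with $1\le i\le m$, $0\le j\le n_i-1$. Then the $p\times p$ matrix $B:=(f_i(-j))$ (row index $i$ and column index $j$ running from $1$ to $p$) is invertible, and for all $z\in\mathbb{C}$ $$A^z=\sum_{i=1}^p\Big(\sum_{j=1}^p (B^{-1})_{ij}f_j(z)\Big)A^{-i}.$$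
   Context: For every $\lambda\in\mathbb{C}^*$ a value $\log(\lambda)$ with $e^{\log(\lambda)}=\lambda$ is fixed once and for all, and $\lambda^z:=e^{z\log(\lambda)}$. Put $g_0(z)=1$ and $g_i(z)=\frac{1}{i!}z(z-1)\cdots(z-i+1)$ for $i\ge 1$. Let $N_k$ be the $k\times k$ matrix with entries $1$ directly above the diagonal and $0$ elsewhere. For a Jordan block $\lambda I_k+N_k$ with $\lambda\ne 0$, define $(\lambda I_k+N_k)^z:=\sum_{i=0}^{k} g_i(z)\lambda^{z-i}N_k^i$. For an invertible matrix $J$ in Jordan normal form, $J^z$ is the block diagonal matrix obtained by replacing each block by its $z$-th power. For an invertible matrix $A$ with $M^{-1}AM=J$ in Jordan normal form, $A^z:=MJ^zM^{-1}$ (this does not depend on the choices of $M$ and $J$). *)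

theory Defs
  imports
    "Jordan_Normal_Form.Jordan_Normal_Form"
    "Jordan_Normal_Form.Gauss_Jordan_Elimination"
begin

(* L is the choice of logarithms; it is only meaningful when exp (L a) = a for all a \<noteq> 0. *)
definition cpow :: "(complex \<Rightarrow> complex) \<Rightarrow> complex \<Rightarrow> complex \<Rightarrow> complex" where
  "cpow L a z = exp (z * L a)"

definition mat_sum :: "nat \<Rightarrow> ('i \<Rightarrow> complex mat) \<Rightarrow> 'i set \<Rightarrow> complex mat" where
  "mat_sum n X I = mat n n (\<lambda>(r, s). \<Sum>i\<in>I. X i $$ (r, s))"

definition mat_poly :: "complex poly \<Rightarrow> complex mat \<Rightarrow> complex mat" where
  "mat_poly q A = mat_sum (dim_row A) (\<lambda>k. coeff q k \<cdot>\<^sub>m (A ^\<^sub>m k)) {0..degree q}"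

definition mat_inv :: "complex mat \<Rightarrow> complex mat" where
  "mat_inv A = the (mat_inverse A)"

lemma mat_inv:
  assumes A: "A \<in> carrier_mat n n" and inv: "invertible_mat A"
  shows "A * mat_inv A = 1\<^sub>m n" "mat_inv A * A = 1\<^sub>m n" "mat_inv A \<in> carrier_mat n n"
proof -
  from inv obtain B where B: "A * B = 1\<^sub>m n" "B * A = 1\<^sub>m (dim_row B)"
    using A unfolding invertible_mat_def inverts_mat_def by auto
  have "dim_col B = n" "dim_row B = n"
    using A arg_cong[OF B(1), of dim_col] arg_cong[OF B(2), of dim_col] by auto
  then have "A \<in> Units (ring_mat TYPE(complex) n ())"
    using A B unfolding Units_def ring_mat_def by auto
  then obtain C where "mat_inverse A = Some C"
    using mat_inverse(1)[OF A, where b = "()"] by (cases "mat_inverse A") auto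
  with mat_inverse(2)[OF A this]
  show "A * mat_inv A = 1\<^sub>m n" "mat_inv A * A = 1\<^sub>m n" "mat_inv A \<in> carrier_mat n n"
    by (auto simp: mat_inv_def)
qed

(* The nilpotent block N_k is jordan_block k 0, and g_i(z) = z (z - 1) ... (z - i + 1) / i!
   is the generalized binomial coefficient z gchoose i. *)
definition jordan_block_cpow :: "(complex \<Rightarrow> complex) \<Rightarrow> nat \<Rightarrow> complex \<Rightarrow> complex \<Rightarrow> complex mat" where
  "jordan_block_cpow L k a z =
     mat_sum k (\<lambda>i. ((z gchoose i) * cpow L a (z - of_nat i)) \<cdot>\<^sub>m (jordan_block k 0 ^\<^sub>m i)) {0..k}"

definition jordan_matrix_cpow :: "(complex \<Rightarrow> complex) \<Rightarrow> (nat \<times> complex) list \<Rightarrow> complex \<Rightarrow> complex mat" where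
  "jordan_matrix_cpow L n_as z = diag_block_mat (map (\<lambda>(k, a). jordan_block_cpow L k a z) n_as)"

(* The result does not depend on the transformation M (with inverse M') nor on the Jordan form,
   so the definite description is well defined for invertible square A. *)
definition mat_cpow :: "(complex \<Rightarrow> complex) \<Rightarrow> complex mat \<Rightarrow> complex \<Rightarrow> complex mat" where
  "mat_cpow L A z =
     (THE X. \<exists>n_as M M'. 0 \<notin> fst ` set n_as \<and> similar_mat_wit A (jordan_matrix n_as) M M' \<and>
        X = M * jordan_matrix_cpow L n_as z * M')"

end

theory Submission
  imports Defs
    "Jordan_Normal_Form.Jordan_Normal_Form_Existence"
    "HOL-Computational_Algebra.Polynomial_FPS"
    "HOL-Computational_Algebra.Fundamental_Theorem_Algebra"
begin

text \<open>The theorem is Hermite interpolation seen through a Jordan normal form.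

The algebra generated by the nilpotent part of a Jordan block is a quotient of formal power series
in $X$: the block with eigenvalue $a$ and size $k$ is the image of $a + X$, and the image of a
series depends on its first $k$ coefficients only. Applied blockwise and conjugated, this gives
a functional calculus \<open>fun_mat\<close> for $A$, whose argument assigns a power series to each eigenvalue.
It is compatible with products and linear combinations, and it sends $a + X$ to $A$. The matrix
$A^z$ is the image of the series $(a + X)^z = \sum_d g_d(z) a^{z-d} X^d$ (\<open>cpow_fps\<close>), and since
$(a + X)^z (a + X) = (a + X)^{z+1}$ the power of the inverse $A^{-i}$ is the image of
$(a + X)^{-i}$. As $Q(A) = 0$, the polynomial $(x - a)^k$ divides $Q$ for each block
(\<open>linear_power_dvd_annihilator\<close>), so every coefficient of $(a + X)^z$ that matters
for a block is among the functions $f_l(z)$. The claimed formula therefore reduces to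
$f_l(z) = \sum_i (\sum_j (B^{-1})_{ij} f_j(z)) f_l(-i)$, which is $B B^{-1} = 1$ because
$f_l(-i) = B_{li}$.

For the invertibility of $B$, a vector $w$ with $B w = 0$ defines the polynomial
$P = \sum_j w_j x^{p-j} = x^p \sum_j w_j x^{-j}$. The equations of $B w = 0$ say that the Taylor
coefficients of $\sum_j w_j x^{-j}$ at each root of $Q$ vanish up to the multiplicity of that root.
So $P$ vanishes at the roots of $Q$ to at least the same order, while its degree is
below $p$; hence $P = 0$ and $w = 0$ (\<open>cpow_sample_kernel_trivial\<close>).

That $A^z$ is well defined needs no separate argument: the formula is derived for an
arbitrary Jordan form of $A$, and its right-hand side does not mention that form.\<close>

section \<open>Power series evaluated at Jordan matrices\<close>

no_notation vec_index (infixl \<open>$\<close> 100)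
notation vec_index (infixl \<open>$v\<close> 100)
notation fps_nth (infixl \<open>$\<close> 75)

text \<open>The value at $X = N_k$ of a power series, where $N_k$ is the nilpotent $k \times k$ shift.\<close>

definition toeplitz :: "nat \<Rightarrow> 'a::comm_ring_1 fps \<Rightarrow> 'a mat" where
  "toeplitz k F = mat k k (\<lambda>(r, s). if r \<le> s then F $ (s - r) else 0)"

lemma toeplitz_carrier [simp]: "toeplitz k F \<in> carrier_mat k k"
  and toeplitz_dim [simp]: "dim_row (toeplitz k F) = k" "dim_col (toeplitz k F) = k"
  and toeplitz_index [simp]:
    "r < k \<Longrightarrow> s < k \<Longrightarrow> toeplitz k F $$ (r, s) = (if r \<le> s then F $ (s - r) else 0)"
  by (auto simp: toeplitz_def)

lemma toeplitz_one: "toeplitz k 1 = 1\<^sub>m k"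
  by (rule eq_matI) auto

text \<open>The convolution of two coefficient sequences is what the product of upper triangular Toeplitz
matrices computes, because row $r$ and column $s$ overlap exactly in the indices from $r$ to $s$.\<close>

lemma toeplitz_mult: "toeplitz k (F * G) = toeplitz k F * toeplitz k G"
proof (rule eq_matI; simp)
  fix r s assume rs: "r < k" "s < k"
  have "(\<Sum>u<k. (if r \<le> u then F $ (u - r) else 0) * (if u \<le> s then G $ (s - u) else 0)) =
        (\<Sum>u\<in>{u. r \<le> u \<and> u \<le> s}. F $ (u - r) * G $ (s - u))"
    using rs by (intro sum.mono_neutral_cong_right) auto
  also have "\<dots> = (if r \<le> s then (F * G) $ (s - r) else 0)"
  proof (cases "r \<le> s")
    case True
    have "(\<Sum>u\<in>{u. r \<le> u \<and> u \<le> s}. F $ (u - r) * G $ (s - u)) =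
          (\<Sum>i = 0..s - r. F $ i * G $ (s - r - i))"
      using True by (intro sum.reindex_bij_witness[of _ "\<lambda>i. i + r" "\<lambda>u. u - r"]) auto
    with True show ?thesis by (simp add: fps_mult_nth)
  next
    case False
    then have "{u. r \<le> u \<and> u \<le> s} = {}" by auto
    with False show ?thesis by (simp only: sum.empty if_False)
  qed
  finally show "(r \<le> s \<longrightarrow> (F * G) $ (s - r) = row (toeplitz k F) r \<bullet> col (toeplitz k G) s) \<and>
       (\<not> r \<le> s \<longrightarrow> row (toeplitz k F) r \<bullet> col (toeplitz k G) s = 0)"
    using rs by (auto simp: scalar_prod_def atLeast0LessThan)
qed

lemma toeplitz_power: "toeplitz k (F ^ i) = toeplitz k F ^\<^sub>m i"
  by (induction i) (simp_all add: toeplitz_one toeplitz_mult power_Suc2 del: power_Suc)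

lemma toeplitz_eq_iff: "toeplitz k F = toeplitz k G \<longleftrightarrow> (\<forall>d<k. F $ d = G $ d)"
proof
  assume eq: "toeplitz k F = toeplitz k G"
  show "\<forall>d<k. F $ d = G $ d"
  proof (intro allI impI)
    fix d assume "d < k"
    with arg_cong[OF eq, of "\<lambda>X. X $$ (0, d)"] show "F $ d = G $ d" by simp
  qed
qed (auto intro!: eq_matI)

lemma jordan_block_eq_toeplitz: "jordan_block k a = toeplitz k (fps_X + fps_const a)"
  by (rule eq_matI) (auto simp: fps_X_def)

text \<open>The series may depend on the eigenvalue: \<open>F a\<close> is to be thought of as the Taylor expansion at $a$
of one function.\<close>

definition jordan_fun :: "(nat \<times> 'a) list \<Rightarrow> ('a \<Rightarrow> 'a::comm_ring_1 fps) \<Rightarrow> 'a mat" where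
  "jordan_fun n_as F = diag_block_mat (map (\<lambda>(k, a). toeplitz k (F a)) n_as)"

lemma jordan_fun_dim [simp]:
  "dim_row (jordan_fun n_as F) = sum_list (map fst n_as)"
  "dim_col (jordan_fun n_as F) = sum_list (map fst n_as)"
  unfolding jordan_fun_def dim_diag_block_mat
  by (induction n_as) auto

lemma jordan_fun_carrier [simp]:
  "jordan_fun n_as F \<in> carrier_mat (sum_list (map fst n_as)) (sum_list (map fst n_as))"
  by (rule carrier_matI) simp_all

lemma jordan_fun_Nil: "jordan_fun [] F = 0\<^sub>m 0 0"
  by (simp add: jordan_fun_def)

lemma jordan_fun_Cons:
  "jordan_fun ((k, a) # n_as) F =
     four_block_mat (toeplitz k (F a)) (0\<^sub>m k (sum_list (map fst n_as)))
       (0\<^sub>m (sum_list (map fst n_as)) k) (jordan_fun n_as F)"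
  using jordan_fun_dim[of n_as F] by (simp add: jordan_fun_def Let_def)

lemma jordan_fun_one: "jordan_fun n_as (\<lambda>_. 1) = 1\<^sub>m (sum_list (map fst n_as))"
  by (induction n_as) (auto simp: jordan_fun_Nil jordan_fun_Cons toeplitz_one intro!: eq_matI)

lemma jordan_fun_mult:
  "jordan_fun n_as (\<lambda>a. F a * G a) = jordan_fun n_as F * jordan_fun n_as G"
proof (induction n_as)
  case (Cons ka n_as)
  obtain k a where [simp]: "ka = (k, a)" by force
  let ?N = "sum_list (map fst n_as)"
  have "jordan_fun n_as F * jordan_fun n_as G \<in> carrier_mat ?N ?N"
    by (rule mult_carrier_mat[OF jordan_fun_carrier jordan_fun_carrier])
  moreover have "toeplitz k (F a) * toeplitz k (G a) \<in> carrier_mat k k"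
    by (rule mult_carrier_mat[OF toeplitz_carrier toeplitz_carrier])
  ultimately show ?case
    by (simp add: jordan_fun_Cons toeplitz_mult Cons
        mult_four_block_mat[of _ k k _ ?N _ ?N _ _ k _ ?N])
qed (auto simp: jordan_fun_Nil)

lemma jordan_fun_lincomb:
  assumes "r < sum_list (map fst n_as)" "s < sum_list (map fst n_as)"
  shows "jordan_fun n_as (\<lambda>a. \<Sum>i\<in>I. fps_const (c i) * F i a) $$ (r, s) =
           (\<Sum>i\<in>I. c i * jordan_fun n_as (F i) $$ (r, s))"
  using assms
proof (induction n_as arbitrary: r s)
  case (Cons ka n_as)
  obtain k a where [simp]: "ka = (k, a)" by force
  show ?case
    using Cons.prems Cons.IH[of "r - k" "s - k"]
    by (auto simp: jordan_fun_Cons fps_sum_nth)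
qed simp

text \<open>A block of size $k$ sees precisely the first $k$ Taylor coefficients at its eigenvalue.\<close>

lemma jordan_fun_eq_iff:
  "jordan_fun n_as F = jordan_fun n_as G \<longleftrightarrow> (\<forall>(k, a)\<in>set n_as. \<forall>d<k. F a $ d = G a $ d)"
proof (induction n_as)
  case (Cons ka n_as)
  obtain k a where [simp]: "ka = (k, a)" by force
  let ?N = "sum_list (map fst n_as)"
  have "toeplitz k (F a) = toeplitz k (G a) \<and> jordan_fun n_as F = jordan_fun n_as G"
    if eq: "jordan_fun (ka # n_as) F = jordan_fun (ka # n_as) G"
  proof
    show "toeplitz k (F a) = toeplitz k (G a)"
    proof (rule eq_matI)
      fix r s assume "r < dim_row (toeplitz k (G a))" "s < dim_col (toeplitz k (G a))"
      then show "toeplitz k (F a) $$ (r, s) = toeplitz k (G a) $$ (r, s)"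
        using arg_cong[OF eq, of "\<lambda>X. X $$ (r, s)"] by (simp add: jordan_fun_Cons)
    qed auto
    show "jordan_fun n_as F = jordan_fun n_as G"
    proof (rule eq_matI)
      fix r s assume "r < dim_row (jordan_fun n_as G)" "s < dim_col (jordan_fun n_as G)"
      then show "jordan_fun n_as F $$ (r, s) = jordan_fun n_as G $$ (r, s)"
        using arg_cong[OF eq, of "\<lambda>X. X $$ (r + k, s + k)"] by (simp add: jordan_fun_Cons)
    qed auto
  qed
  then have "jordan_fun (ka # n_as) F = jordan_fun (ka # n_as) G \<longleftrightarrow>
      toeplitz k (F a) = toeplitz k (G a) \<and> jordan_fun n_as F = jordan_fun n_as G"
    by (auto simp: jordan_fun_Cons)
  then show ?case by (simp add: toeplitz_eq_iff Cons)
qed (simp add: jordan_fun_Nil)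

lemma jordan_matrix_eq_jordan_fun: "jordan_matrix n_as = jordan_fun n_as (\<lambda>a. fps_X + fps_const a)"
  by (simp add: jordan_matrix_def jordan_fun_def jordan_block_eq_toeplitz)

section \<open>The functional calculus of a matrix with a given Jordan form\<close>

lemma mat_sum_carrier [simp]: "mat_sum n X I \<in> carrier_mat n n"
  by (simp add: mat_sum_def)

lemma mult_mat_sum:
  assumes M: "M \<in> carrier_mat n n" and X: "\<And>i. i \<in> I \<Longrightarrow> X i \<in> carrier_mat n n"
  shows "M * mat_sum n X I = mat_sum n (\<lambda>i. M * X i) I"
proof (rule eq_matI)
  fix r s assume rs: "r < dim_row (mat_sum n (\<lambda>i. M * X i) I)" "s < dim_col (mat_sum n (\<lambda>i. M * X i) I)"
  then have rs: "r < n" "s < n" by (auto simp: mat_sum_def)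
  have "(M * mat_sum n X I) $$ (r, s) = (\<Sum>u<n. \<Sum>i\<in>I. M $$ (r, u) * X i $$ (u, s))"
    using rs M by (auto simp: mat_sum_def scalar_prod_def atLeast0LessThan sum_distrib_left)
  also have "\<dots> = (\<Sum>i\<in>I. \<Sum>u<n. M $$ (r, u) * X i $$ (u, s))" by (rule sum.swap)
  also have "\<dots> = (\<Sum>i\<in>I. (M * X i) $$ (r, s))"
    using rs M X by (intro sum.cong) (auto simp: scalar_prod_def atLeast0LessThan dest!: X)
  finally show "(M * mat_sum n X I) $$ (r, s) = mat_sum n (\<lambda>i. M * X i) I $$ (r, s)"
    using rs by (simp add: mat_sum_def)
qed (use M in \<open>auto simp: mat_sum_def\<close>)

lemma mat_sum_mult:
  assumes M: "M \<in> carrier_mat n n" and X: "\<And>i. i \<in> I \<Longrightarrow> X i \<in> carrier_mat n n"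
  shows "mat_sum n X I * M = mat_sum n (\<lambda>i. X i * M) I"
proof (rule eq_matI)
  fix r s assume rs: "r < dim_row (mat_sum n (\<lambda>i. X i * M) I)" "s < dim_col (mat_sum n (\<lambda>i. X i * M) I)"
  then have rs: "r < n" "s < n" by (auto simp: mat_sum_def)
  have "(mat_sum n X I * M) $$ (r, s) = (\<Sum>u<n. \<Sum>i\<in>I. X i $$ (r, u) * M $$ (u, s))"
    using rs M by (auto simp: mat_sum_def scalar_prod_def atLeast0LessThan sum_distrib_right)
  also have "\<dots> = (\<Sum>i\<in>I. \<Sum>u<n. X i $$ (r, u) * M $$ (u, s))" by (rule sum.swap)
  also have "\<dots> = (\<Sum>i\<in>I. (X i * M) $$ (r, s))"
    using rs M X by (intro sum.cong) (auto simp: scalar_prod_def atLeast0LessThan dest!: X)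
  finally show "(mat_sum n X I * M) $$ (r, s) = mat_sum n (\<lambda>i. X i * M) I $$ (r, s)"
    using rs by (simp add: mat_sum_def)
qed (use M in \<open>auto simp: mat_sum_def\<close>)

lemma mat_sum_cong: "(\<And>i. i \<in> I \<Longrightarrow> X i = Y i) \<Longrightarrow> mat_sum n X I = mat_sum n Y I"
  by (simp add: mat_sum_def)

lemma mat_sum_jordan_fun:
  "mat_sum (sum_list (map fst n_as)) (\<lambda>i. c i \<cdot>\<^sub>m jordan_fun n_as (F i)) I =
     jordan_fun n_as (\<lambda>a. \<Sum>i\<in>I. fps_const (c i) * F i a)"
  by (rule eq_matI) (auto simp: mat_sum_def jordan_fun_lincomb)

locale jordan_similarity =
  fixes n :: nat and A :: "complex mat" and n_as :: "(nat \<times> complex) list" and M M' :: "complex mat"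
  assumes carrier: "A \<in> carrier_mat n n"
    and similar: "similar_mat_wit A (jordan_matrix n_as) M M'"
begin

definition fun_mat :: "(complex \<Rightarrow> complex fps) \<Rightarrow> complex mat" where
  "fun_mat F = M * jordan_fun n_as F * M'"

lemma M: "M \<in> carrier_mat n n" "M' \<in> carrier_mat n n" "M * M' = 1\<^sub>m n" "M' * M = 1\<^sub>m n"
  and size: "sum_list (map fst n_as) = n"
  using similar_mat_witD2[OF carrier similar] by auto

lemma jordan_fun_carrier_n [simp]: "jordan_fun n_as F \<in> carrier_mat n n"
  using jordan_fun_carrier[of n_as F] by (simp only: size)

lemma fun_mat_carrier [simp]: "fun_mat F \<in> carrier_mat n n"
  using M by (auto simp: fun_mat_def)

lemma fun_mat_one: "fun_mat (\<lambda>_. 1) = 1\<^sub>m n"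
  using M by (simp add: fun_mat_def jordan_fun_one size)

lemma fun_mat_id: "fun_mat (\<lambda>a. fps_X + fps_const a) = A"
  using similar_mat_witD2[OF carrier similar] by (simp add: fun_mat_def jordan_matrix_eq_jordan_fun)

lemma conj_cancel:
  assumes X: "X \<in> carrier_mat n n" shows "M' * (M * X * M') * M = X"
proof -
  have "M' * (M * X * M') * M = (M' * M) * X * (M' * M)"
    using M(1,2) X by (simp add: assoc_mult_mat[of _ n n _ n _ n] mult_carrier_mat[of _ n n _ n])
  then show ?thesis using M X by simp
qed

lemma fun_mat_mult: "fun_mat (\<lambda>a. F a * G a) = fun_mat F * fun_mat G"
proof -
  let ?F = "jordan_fun n_as F" and ?G = "jordan_fun n_as G"
  have "fun_mat F * fun_mat G = M * ?F * (M' * M) * ?G * M'"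
    using M(1,2) by (simp add: fun_mat_def
        assoc_mult_mat[of _ n n _ n _ n] mult_carrier_mat[of _ n n _ n])
  also have "\<dots> = M * (?F * ?G) * M'"
    using M by (simp add: assoc_mult_mat[of _ n n _ n _ n] mult_carrier_mat[of _ n n _ n]
        left_mult_one_mat[of _ n n])
  finally show ?thesis by (simp add: fun_mat_def jordan_fun_mult)
qed

lemma fun_mat_power: "fun_mat (\<lambda>a. F a ^ i) = fun_mat F ^\<^sub>m i"
proof (induction i)
  case 0
  show ?case using carrier_matD(1)[OF fun_mat_carrier[of F]] by (simp add: fun_mat_one)
next
  case (Suc i)
  then show ?case by (simp add: power_Suc2 fun_mat_mult del: power_Suc)
qed

lemma fun_mat_lincomb:
  "mat_sum n (\<lambda>i. c i \<cdot>\<^sub>m fun_mat (F i)) I = fun_mat (\<lambda>a. \<Sum>i\<in>I. fps_const (c i) * F i a)"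
proof -
  have "mat_sum n (\<lambda>i. c i \<cdot>\<^sub>m fun_mat (F i)) I =
        mat_sum n (\<lambda>i. M * (c i \<cdot>\<^sub>m jordan_fun n_as (F i)) * M') I"
    using M by (intro mat_sum_cong)
      (simp add: fun_mat_def mult_smult_distrib[where nr = n and n = n and nc = n]
        mult_smult_assoc_mat[where nr = n and n = n and nc = n])
  also have "\<dots> = M * mat_sum n (\<lambda>i. c i \<cdot>\<^sub>m jordan_fun n_as (F i)) I * M'"
    using M by (simp add: mat_sum_mult mult_mat_sum)
  finally show ?thesis
    using mat_sum_jordan_fun[of n_as c F I] by (simp add: fun_mat_def size)
qed

lemma fun_mat_eq_iff:
  "fun_mat F = fun_mat G \<longleftrightarrow> (\<forall>(k, a)\<in>set n_as. \<forall>d<k. F a $ d = G a $ d)"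
proof -
  have "fun_mat F = fun_mat G \<longleftrightarrow> jordan_fun n_as F = jordan_fun n_as G"
    unfolding fun_mat_def
    by (metis conj_cancel jordan_fun_carrier_n)
  then show ?thesis by (simp add: jordan_fun_eq_iff)
qed

end

section \<open>Taylor coefficients of polynomials\<close>

lemma pcompose_power: "pcompose (p ^ i) q = pcompose p q ^ i"
  by (induction i) (simp_all add: pcompose_mult pcompose_1)

lemma pcompose_eq_sum: "pcompose q r = (\<Sum>i\<le>degree q. Polynomial.smult (coeff q i) (r ^ i))"
proof -
  have "pcompose q r = pcompose (\<Sum>i\<le>degree q. Polynomial.smult (coeff q i) ([:0, 1:] ^ i)) r"
    by (simp add: poly_as_sum_of_monoms flip: monom_altdef)
  then show ?thesis by (simp add: pcompose_sum pcompose_smult pcompose_power pcompose_pCons)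
qed

text \<open>Substituting $a + x$ for $x$ moves the root $a$ to the origin, where divisibility by $x^k$ can be
read off the coefficients.\<close>

lemma linear_power_dvd_iff:
  "[:-a, 1:] ^ k dvd q \<longleftrightarrow> (\<forall>d<k. coeff (pcompose q [:a, 1:]) d = 0)" for a :: "'a::field"
proof -
  have "[:-a, 1:] ^ k dvd q \<longleftrightarrow> [:0, 1:] ^ k dvd pcompose q [:a, 1:]"
  proof
    assume "[:-a, 1:] ^ k dvd q"
    then obtain s where "q = [:-a, 1:] ^ k * s" by (auto elim: dvdE)
    then have "pcompose q [:a, 1:] = [:0, 1:] ^ k * pcompose s [:a, 1:]"
      by (simp add: pcompose_mult pcompose_power pcompose_pCons)
    then show "[:0, 1:] ^ k dvd pcompose q [:a, 1:]" by simp
  next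
    assume "[:0, 1:] ^ k dvd pcompose q [:a, 1:]"
    then obtain s where s: "pcompose q [:a, 1:] = [:0, 1:] ^ k * s" by (auto elim: dvdE)
    have "q = pcompose (pcompose q [:a, 1:]) [:-a, 1:]"
      by (simp add: pcompose_assoc[symmetric] pcompose_pCons)
    also have "\<dots> = [:-a, 1:] ^ k * pcompose s [:-a, 1:]"
      by (simp add: s pcompose_mult pcompose_power pcompose_pCons)
    finally show "[:-a, 1:] ^ k dvd q" by simp
  qed
  then show ?thesis by (simp flip: monom_1_dvd_iff' add: monom_altdef)
qed

lemma degree_eq_sum_order:
  fixes p :: "complex poly" assumes "p \<noteq> 0"
  shows "degree p = (\<Sum>a | poly p a = 0. order a p)"
proof -
  have "degree p = degree (Polynomial.smult (lead_coeff p) (\<Prod>a | poly p a = 0. [:-a, 1:] ^ order a p))"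
    by (simp add: complex_poly_decompose)
  also have "\<dots> = (\<Sum>a | poly p a = 0. degree ([:-a, 1:] ^ order a p))"
    using assms by (simp add: degree_prod_eq_sum_degree)
  finally show ?thesis by (simp add: degree_linear_power)
qed

text \<open>Over the complex numbers the degree counts the roots with multiplicity, so a nonzero polynomial that
vanishes at the roots of $q$ to at least the same orders has at least as many roots as $q$.\<close>

lemma degree_le_if_linear_powers_dvd:
  fixes q r :: "complex poly"
  assumes "q \<noteq> 0" "r \<noteq> 0" and dvd: "\<And>a. [:-a, 1:] ^ order a q dvd r"
  shows "degree q \<le> degree r"
proof -
  have le: "order a q \<le> order a r" for a using dvd[of a] \<open>r \<noteq> 0\<close> by (simp add: order_divides)
  have "{a. poly q a = 0} \<subseteq> {a. poly r a = 0}"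
    using le assms(1,2) by (metis (mono_tags) Collect_mono le_zero_eq order_root)
  then show ?thesis
    using assms(1,2) le by (auto simp: degree_eq_sum_order poly_roots_finite
        intro!: order_trans[OF sum_mono sum_mono2])
qed

section \<open>Complex powers as power series\<close>

text \<open>The binomial series of $(a + X)^z$, for the branch of $a^z$ chosen by \<open>L\<close>.\<close>

definition cpow_fps :: "(complex \<Rightarrow> complex) \<Rightarrow> complex \<Rightarrow> complex \<Rightarrow> complex fps" where
  "cpow_fps L a z = Abs_fps (\<lambda>d. (z gchoose d) * cpow L a (z - of_nat d))"

lemma cpow_fps_nth [simp]: "cpow_fps L a z $ d = (z gchoose d) * cpow L a (z - of_nat d)"
  by (simp add: cpow_fps_def)

lemma cpow_fps_0: "cpow_fps L a 0 = 1"
proof (rule fps_ext)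
  fix d show "cpow_fps L a 0 $ d = 1 $ d" by (cases d) (auto simp: cpow_def gbinomial_0)
qed

text \<open>Coefficientwise this is Pascal's rule for generalized binomial coefficients. It uses the choice of
logarithm only through $a^{w+1} = a \cdot a^w$.\<close>

lemma cpow_fps_mult:
  assumes "exp (L a) = a"
  shows "cpow_fps L a z * (fps_X + fps_const a) = cpow_fps L a (z + 1)"
proof (rule fps_ext)
  fix d
  have add1: "cpow L a (w + 1) = a * cpow L a w" for w
    using assms by (simp add: cpow_def distrib_right exp_add)
  show "(cpow_fps L a z * (fps_X + fps_const a)) $ d = cpow_fps L a (z + 1) $ d"
  proof (cases d)
    case 0
    then show ?thesis using add1[of z] by (simp add: distrib_left)
  next
    case (Suc d')
    have "cpow L a (z - of_nat d') = a * cpow L a (z - of_nat d)"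
      using add1[of "z - of_nat d"] Suc by (simp add: algebra_simps)
    moreover have "z + 1 - of_nat d = z - of_nat d'" using Suc by simp
    ultimately show ?thesis
      using Suc by (simp add: distrib_left gbinomial_Suc_Suc) (simp add: algebra_simps)
  qed
qed

lemma cpow_fps_neg_mult_power:
  assumes "exp (L a) = a" "j \<le> p"
  shows "cpow_fps L a (- of_nat j) * (fps_X + fps_const a) ^ p = (fps_X + fps_const a) ^ (p - j)"
proof -
  have inverse: "cpow_fps L a (- of_nat j) * (fps_X + fps_const a) ^ j = 1" for j
  proof (induction j)
    case 0
    show ?case by (simp add: cpow_fps_0)
  next
    case (Suc j)
    have "cpow_fps L a (- of_nat (Suc j)) * (fps_X + fps_const a) = cpow_fps L a (- of_nat j)"
      using cpow_fps_mult[of L a "- of_nat (Suc j)"] assms(1) by simp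
    with Suc show ?case by (simp add: mult.assoc[symmetric])
  qed
  have "(fps_X + fps_const a) ^ p = (fps_X + fps_const a) ^ j * (fps_X + fps_const a) ^ (p - j)"
    by (simp only: power_add[symmetric] le_add_diff_inverse[OF assms(2)])
  then show ?thesis by (simp only: mult.assoc[symmetric] inverse mult_1)
qed

text \<open>The finite sum that defines the power of a block and the power series agree in all
coefficients that occur in a $k \times k$ matrix.\<close>

lemma jordan_block_cpow_eq_toeplitz: "jordan_block_cpow L k a z = toeplitz k (cpow_fps L a z)"
proof (rule eq_matI)
  fix r s assume "r < dim_row (toeplitz k (cpow_fps L a z))" "s < dim_col (toeplitz k (cpow_fps L a z))"
  then have rs: "r < k" "s < k" by auto
  have "jordan_block k (0::complex) ^\<^sub>m i = toeplitz k (fps_X ^ i)" for i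
    by (simp add: jordan_block_eq_toeplitz toeplitz_power)
  then have N: "(jordan_block k (0::complex) ^\<^sub>m i) $$ (r, s) = (if i = s - r then if r \<le> s then 1 else 0 else 0)" for i
    using rs by (simp add: fps_X_power_nth)
  have dim: "dim_row (jordan_block k (0::complex) ^\<^sub>m i) = k" "dim_col (jordan_block k (0::complex) ^\<^sub>m i) = k" for i
    using pow_carrier_mat[OF jordan_block_carrier[of k "0::complex"], of i] by auto
  have "jordan_block_cpow L k a z $$ (r, s) =
      (\<Sum>i = 0..k. cpow_fps L a z $ i * (jordan_block k 0 ^\<^sub>m i) $$ (r, s))"
    using rs by (simp add: jordan_block_cpow_def mat_sum_def dim)
  also have "\<dots> = (\<Sum>i = 0..k. if i = s - r then (if r \<le> s then cpow_fps L a z $ i else 0) else 0)"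
    by (intro sum.cong) (simp_all add: N)
  also have "\<dots> = toeplitz k (cpow_fps L a z) $$ (r, s)" using rs by (auto simp: sum.delta)
  finally show "jordan_block_cpow L k a z $$ (r, s) = toeplitz k (cpow_fps L a z) $$ (r, s)" .
qed (auto simp: jordan_block_cpow_def mat_sum_def)

lemma jordan_matrix_cpow_eq_jordan_fun:
  "jordan_matrix_cpow L n_as z = jordan_fun n_as (\<lambda>a. cpow_fps L a z)"
  by (simp add: jordan_matrix_cpow_def jordan_fun_def jordan_block_cpow_eq_toeplitz)

section \<open>Integer powers and annihilating polynomials\<close>

context jordan_similarity
begin

lemma mat_poly_eq_fun_mat: "mat_poly q A = fun_mat (\<lambda>a. fps_of_poly (pcompose q [:a, 1:]))"
proof -
  have "mat_poly q A = mat_sum n (\<lambda>i. coeff q i \<cdot>\<^sub>m fun_mat (\<lambda>a. (fps_X + fps_const a) ^ i)) {0..degree q}"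
    using carrier by (simp add: mat_poly_def fun_mat_power fun_mat_id)
  also have "\<dots> = fun_mat (\<lambda>a. fps_of_poly (pcompose q [:a, 1:]))"
    by (simp add: fun_mat_lincomb pcompose_eq_sum[of q] fps_of_poly_sum fps_of_poly_smult
        fps_of_poly_power fps_of_poly_linear atLeast0AtMost)
  finally show ?thesis .
qed

text \<open>Vanishing of $q(A)$ on a block means that the first $k$ Taylor coefficients of $q$ at the eigenvalue
vanish. Hence the block size is bounded by the multiplicity of the eigenvalue as a root of $q$.\<close>

lemma linear_power_dvd_annihilator:
  assumes "mat_poly q A = 0\<^sub>m n n" "(k, a) \<in> set n_as"
  shows "[:-a, 1:] ^ k dvd q"
proof -
  have "fun_mat (\<lambda>a. \<Sum>i\<in>{}. fps_const 0 * 0) = 0\<^sub>m n n"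
    by (subst fun_mat_lincomb[symmetric]) (auto simp: mat_sum_def)
  then have "fun_mat (\<lambda>a. fps_of_poly (pcompose q [:a, 1:])) = fun_mat (\<lambda>_. 0)"
    using assms(1) by (simp add: mat_poly_eq_fun_mat)
  then show ?thesis
    using assms(2) by (auto simp: fun_mat_eq_iff linear_power_dvd_iff)
qed

text \<open>Both sides are $1$ for $i = 0$, and multiplying by $A$ lowers $i$ by one on both sides; on the
right this is the rule $(a + X)^{-i-1} (a + X) = (a + X)^{-i}$.\<close>

lemma mat_inv_power_eq_fun_mat:
  assumes inv: "invertible_mat A" and L: "\<And>k a. (k, a) \<in> set n_as \<Longrightarrow> exp (L a) = a"
  shows "mat_inv A ^\<^sub>m i = fun_mat (\<lambda>a. cpow_fps L a (- of_nat i))"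
proof (induction i)
  case 0
  show ?case using mat_inv(3)[OF carrier inv] by (simp add: cpow_fps_0 fun_mat_one)
next
  case (Suc i)
  let ?X = "\<lambda>i. fun_mat (\<lambda>a. cpow_fps L a (- of_nat i))"
  have "?X (Suc i) * A = fun_mat (\<lambda>a. cpow_fps L a (- of_nat (Suc i)) * (fps_X + fps_const a))"
    by (simp only: fun_mat_mult fun_mat_id)
  also have "\<dots> = ?X i"
    unfolding fun_mat_eq_iff
  proof (intro ballI, clarify)
    fix k a d assume "(k, a) \<in> set n_as"
    from cpow_fps_mult[of L a "- of_nat (Suc i)", OF L[OF this]]
    show "(cpow_fps L a (- of_nat (Suc i)) * (fps_X + fps_const a)) $ d = cpow_fps L a (- of_nat i) $ d"
      by simp
  qed
  finally have "?X i * mat_inv A = ?X (Suc i) * A * mat_inv A" by (rule arg_cong[OF sym])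
  also have "\<dots> = ?X (Suc i) * (A * mat_inv A)"
    by (rule assoc_mult_mat[OF fun_mat_carrier carrier mat_inv(3)[OF carrier inv]])
  also have "\<dots> = ?X (Suc i)"
    using right_mult_one_mat[OF fun_mat_carrier] by (simp only: mat_inv(1)[OF carrier inv])
  finally show ?case by (simp add: Suc)
qed

end

section \<open>The interpolation formula\<close>

lemma complex_jordan_nf_exists:
  fixes A :: "complex mat"
  assumes "A \<in> carrier_mat n n"
  obtains n_as M M' where "0 \<notin> fst ` set n_as" "similar_mat_wit A (jordan_matrix n_as) M M'"
proof -
  obtain as where "char_poly A = (\<Prod>a\<leftarrow>as. [:- a, 1:])"
    using char_poly_factorized[OF assms] by blast
  then obtain n_as where "jordan_nf A n_as" using jordan_nf_exists[OF assms] by blast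
  then show ?thesis using that by (auto simp: jordan_nf_def similar_mat_def)
qed

text \<open>Some Jordan form exists, so the definite description denotes \<open>X\<close> as soon as every Jordan form yields
the value \<open>X\<close>.\<close>

lemma mat_cpow_eqI:
  assumes A: "A \<in> carrier_mat n n"
    and X: "\<And>n_as M M'. 0 \<notin> fst ` set n_as \<Longrightarrow> similar_mat_wit A (jordan_matrix n_as) M M' \<Longrightarrow>
              M * jordan_matrix_cpow L n_as z * M' = X"
  shows "mat_cpow L A z = X"
proof -
  obtain n_as M M' where "0 \<notin> fst ` set n_as" "similar_mat_wit A (jordan_matrix n_as) M M'"
    using complex_jordan_nf_exists[OF A] .
  then show ?thesis
    unfolding mat_cpow_def using X by (intro the_equality) blast+
qed

lemma invertible_mat_if_kernel_trivial:
  fixes B :: "'a::field mat"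
  assumes B: "B \<in> carrier_mat p p"
    and ker: "\<And>w. w \<in> carrier_vec p \<Longrightarrow> B *\<^sub>v w = 0\<^sub>v p \<Longrightarrow> w = 0\<^sub>v p"
  shows "invertible_mat B"
proof -
  have "det B \<noteq> 0" using det_0_iff_vec_prod_zero_field[OF B] ker by blast
  from det_non_zero_imp_unit[OF B this, of "()"]
  obtain C where "C \<in> carrier_mat p p" "C * B = 1\<^sub>m p" "B * C = 1\<^sub>m p"
    unfolding Units_def ring_mat_def by auto
  then show ?thesis using B unfolding invertible_mat_def inverts_mat_def by auto
qed

text \<open>The columns of the interpolation matrix are linearly independent. A relation \<open>w\<close> between them says
that $h(x) = \sum_j w_j x^{-j}$ vanishes at every root $a$ of $Q$ to the order of $a$ in $Q$. The
polynomial $P(x) = x^p h(x)$, with $p$ the degree of $Q$, inherits these zeros but has degree less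
than $p$, so it is zero, and its coefficients are the $w_j$. The roots of $Q$ must be
nonzero for $x^{-j}$ to have a Taylor expansion there.\<close>

lemma cpow_sample_kernel_trivial:
  fixes w :: "nat \<Rightarrow> complex"
  assumes L: "\<And>a. a \<noteq> 0 \<Longrightarrow> exp (L a) = a"
    and Q: "Q \<noteq> 0" "poly Q 0 \<noteq> 0"
    and ker: "\<And>a d. d < order a Q \<Longrightarrow> (\<Sum>j = 1..degree Q. w j * cpow_fps L a (- of_nat j) $ d) = 0"
    and j: "j \<in> {1..degree Q}"
  shows "w j = 0"
proof -
  let ?p = "degree Q"
  define P where "P = (\<Sum>j = 1..?p. monom (w j) (?p - j))"
  have "[:-a, 1:] ^ order a Q dvd P" for a
  proof (cases "a = 0")
    case True
    then show ?thesis using Q by (simp add: order_0I)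
  next
    case False
    \<comment> \<open>\<open>S\<close> is the expansion of $h$ at $a$, and \<open>Y\<close> that of the variable $x$.\<close>
    define S where "S = (\<Sum>j = 1..?p. fps_const (w j) * cpow_fps L a (- of_nat j))"
    define Y where "Y = fps_X + fps_const a"
    have Y: "fps_of_poly [:a, 1:] = Y" by (simp only: Y_def fps_of_poly_linear)
    have X: "pcompose [:0, 1:] [:a, 1:] = [:a, 1:]" by (simp add: pcompose_pCons)
    have "fps_of_poly (pcompose P [:a, 1:]) = (\<Sum>j = 1..?p. fps_const (w j) * Y ^ (?p - j))"
      by (simp only: P_def monom_altdef pcompose_sum pcompose_smult pcompose_power X
          fps_of_poly_sum fps_of_poly_smult fps_of_poly_power Y)
    also have "\<dots> = (\<Sum>j = 1..?p. fps_const (w j) * cpow_fps L a (- of_nat j) * Y ^ ?p)"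
    proof (rule sum.cong[OF refl])
      fix j assume "j \<in> {1..?p}"
      then have "Y ^ (?p - j) = cpow_fps L a (- of_nat j) * Y ^ ?p"
        using cpow_fps_neg_mult_power[of L a j ?p, OF L[OF False]] by (simp only: Y_def atLeastAtMost_iff)
      then show "fps_const (w j) * Y ^ (?p - j) = fps_const (w j) * cpow_fps L a (- of_nat j) * Y ^ ?p"
        by (simp only: mult.assoc)
    qed
    also have "\<dots> = S * Y ^ ?p" by (simp only: S_def sum_distrib_right)
    finally have eq: "fps_of_poly (pcompose P [:a, 1:]) = S * Y ^ ?p" .
    have S: "S $ d = 0" if "d < order a Q" for d
      using ker[OF that] by (simp add: S_def fps_sum_nth)
    have "coeff (pcompose P [:a, 1:]) d = 0" if "d < order a Q" for d
    proof -
      have "coeff (pcompose P [:a, 1:]) d = (S * Y ^ ?p) $ d" by (simp only: eq[symmetric] fps_of_poly_nth)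
      also have "\<dots> = 0" unfolding fps_mult_nth using S that by (intro sum.neutral) simp
      finally show ?thesis .
    qed
    then show ?thesis by (simp add: linear_power_dvd_iff)
  qed
  moreover have "degree P < ?p"
  proof -
    have "degree P \<le> ?p - 1"
      unfolding P_def
      by (intro degree_sum_le) (auto intro: order_trans[OF degree_monom_le])
    with j show ?thesis by auto
  qed
  ultimately have "P = 0"
    using degree_le_if_linear_powers_dvd[OF Q(1), of P] by force
  moreover have "coeff P (?p - j) = (\<Sum>i = 1..?p. if i = j then w i else 0)"
    unfolding P_def coeff_sum coeff_monom
    using j by (intro sum.cong) auto
  ultimately show ?thesis using j by simp
qed

theorem lemma6p1:
  fixes L :: "complex \<Rightarrow> complex"
    and n p m :: nat
    and A B :: "complex mat"
    and c :: "nat \<Rightarrow> complex"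
    and Q :: "complex poly"
    and lam :: "nat \<Rightarrow> complex"
    and mult :: "nat \<Rightarrow> nat"
    and e :: "nat \<Rightarrow> nat \<times> nat"
    and f :: "nat \<Rightarrow> complex \<Rightarrow> complex"
  assumes L: "\<And>a. a \<noteq> 0 \<Longrightarrow> exp (L a) = a"
    and n: "n \<ge> 1"
    and p: "p \<ge> 1"
    and A: "A \<in> carrier_mat n n" "invertible_mat A"
    and Q: "Q = monom 1 p - (\<Sum>k<p. monom (c k) k)"
    and c0: "c 0 \<noteq> 0"
    and QA: "mat_poly Q A = 0\<^sub>m n n"
    and lam: "bij_betw lam {1..m} {x. poly Q x = 0}"
    and mult: "\<And>i. i \<in> {1..m} \<Longrightarrow> mult i = order (lam i) Q"
    and e: "bij_betw e {1..p} {(i, j). i \<in> {1..m} \<and> j < mult i}"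
    and f: "\<And>k i j z. k \<in> {1..p} \<Longrightarrow> e k = (i, j) \<Longrightarrow>
              f k z = (z gchoose j) * cpow L (lam i) (z - of_nat j)"
    and B: "B = mat p p (\<lambda>(i, j). f (i + 1) (- of_nat (j + 1)))"
  shows "invertible_mat B \<and>
    (\<forall>z. mat_cpow L A z =
      mat_sum n (\<lambda>i. (\<Sum>j = 1..p. mat_inv B $$ (i - 1, j - 1) * f j z) \<cdot>\<^sub>m (mat_inv A ^\<^sub>m i)) {1..p})"
proof -
  have coeff_Q: "coeff Q i = (if i = p then 1 else if i < p then - c i else 0)" for i
    by (auto simp: Q coeff_sum coeff_monom sum.delta)
  have deg_Q: "degree Q = p"
    by (rule antisym[OF degree_le le_degree]) (auto simp: coeff_Q)
  have Q0: "Q \<noteq> 0" "poly Q 0 \<noteq> 0"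
    using coeff_Q[of p] coeff_Q[of 0] p c0 by (auto simp: poly_0_coeff_0)

  \<comment> \<open>Every Taylor coefficient of $x^z$ at a root of $Q$, below the multiplicity, is one of the $f_l$.
     Matrix indices start at $0$ and the enumeration \<open>f\<close> starts at $1$.\<close>
  have row: "\<exists>l<p. \<forall>z. f (l + 1) z = cpow_fps L a z $ d" if d: "d < order a Q" for a d
  proof -
    have "poly Q a = 0" using d by (metis less_zeroE order_0I)
    then obtain i where i: "i \<in> {1..m}" "lam i = a"
      using bij_betw_imp_surj_on[OF lam] by (metis (mono_tags) imageE mem_Collect_eq)
    then have "(i, d) \<in> e ` {1..p}"
      using d mult[OF i(1)] bij_betw_imp_surj_on[OF e] by simp
    then obtain l where l: "l \<in> {1..p}" "e l = (i, d)" by force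
    then show ?thesis using f[OF l] i(2) by (intro exI[of _ "l - 1"]) auto
  qed

  have B_carrier: "B \<in> carrier_mat p p" by (simp add: B)
  have B_inv: "invertible_mat B"
  proof (rule invertible_mat_if_kernel_trivial[OF B_carrier])
    fix w assume w: "w \<in> carrier_vec p" and Bw: "B *\<^sub>v w = 0\<^sub>v p"
    have "w $v (j - 1) = 0" if "j \<in> {1..degree Q}" for j
    proof (rule cpow_sample_kernel_trivial[OF L Q0 _ that])
      fix a d assume "d < order a Q"
      then obtain l where l: "l < p" "\<And>z. f (l + 1) z = cpow_fps L a z $ d" using row by blast
      have "0 = (B *\<^sub>v w) $v l" using Bw l(1) by simp
      also have "\<dots> = (\<Sum>j<p. w $v j * cpow_fps L a (- of_nat (j + 1)) $ d)"
        using l w by (auto simp: B scalar_prod_def atLeast0LessThan mult.commute intro!: sum.cong)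
      also have "\<dots> = (\<Sum>j = 1..p. w $v (j - 1) * cpow_fps L a (- of_nat j) $ d)"
        by (intro sum.reindex_bij_witness[of _ "\<lambda>j. j - 1" "\<lambda>j. j + 1"]) auto
      finally show "(\<Sum>j = 1..degree Q. w $v (j - 1) * cpow_fps L a (- of_nat j) $ d) = 0"
        by (simp only: deg_Q)
    qed
    from this[of "_ + 1"] show "w = 0\<^sub>v p" using w by (intro eq_vecI) (auto simp: deg_Q)
  qed

  define C where "C = mat_inv B"
  have C: "C \<in> carrier_mat p p" "B * C = 1\<^sub>m p"
    using mat_inv[OF B_carrier B_inv] by (auto simp: C_def)

  \<comment> \<open>The combination of negative integer powers is exact on each $f_l$, since $B B^{-1} = 1$.\<close>
  have interpolation:
    "(\<Sum>i = 1..p. (\<Sum>j = 1..p. C $$ (i - 1, j - 1) * f j z) * f l (- of_nat i)) = f l z"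
    if l: "l \<in> {1..p}" for l z
  proof -
    have BC: "(\<Sum>i = 1..p. f l (- of_nat i) * C $$ (i - 1, j - 1)) = (if l = j then 1 else 0)"
      if j: "j \<in> {1..p}" for j
    proof -
      have "(\<Sum>i = 1..p. f l (- of_nat i) * C $$ (i - 1, j - 1)) =
            (\<Sum>i<p. f l (- of_nat (i + 1)) * C $$ (i, j - 1))"
        by (intro sum.reindex_bij_witness[of _ "\<lambda>j. j + 1" "\<lambda>j. j - 1"]) auto
      also have "\<dots> = (B * C) $$ (l - 1, j - 1)"
        using l j C(1) by (auto simp: B scalar_prod_def atLeast0LessThan)
      also have "\<dots> = (if l = j then 1 else 0)" using l j by (auto simp: C(2))
      finally show ?thesis .
    qed
    have "(\<Sum>i = 1..p. (\<Sum>j = 1..p. C $$ (i - 1, j - 1) * f j z) * f l (- of_nat i)) =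
          (\<Sum>i = 1..p. \<Sum>j = 1..p. f l (- of_nat i) * C $$ (i - 1, j - 1) * f j z)"
      by (simp add: sum_distrib_right sum_distrib_left mult_ac)
    also have "\<dots> = (\<Sum>j = 1..p. (\<Sum>i = 1..p. f l (- of_nat i) * C $$ (i - 1, j - 1)) * f j z)"
      by (subst sum.swap) (simp add: sum_distrib_right)
    also have "\<dots> = (\<Sum>j = 1..p. if l = j then f j z else 0)"
      using BC by (intro sum.cong) auto
    also have "\<dots> = f l z" using l by simp
    finally show ?thesis .
  qed

  have "mat_cpow L A z =
      mat_sum n (\<lambda>i. (\<Sum>j = 1..p. C $$ (i - 1, j - 1) * f j z) \<cdot>\<^sub>m (mat_inv A ^\<^sub>m i)) {1..p}" for z
  proof (rule mat_cpow_eqI[OF A(1)])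
    fix n_as M M'
    assume pos: "0 \<notin> fst ` set n_as" and wit: "similar_mat_wit A (jordan_matrix n_as) M M'"
    interpret jordan_similarity n A n_as M M' by unfold_locales (fact A(1) wit)+
    have order: "k \<le> order a Q" if "(k, a) \<in> set n_as" for k a
      using linear_power_dvd_annihilator[OF QA that] Q0(1) by (simp add: order_divides)
    \<comment> \<open>The eigenvalues are roots of $Q$, and $Q(0) \<noteq> 0$, so the chosen logarithm is valid at them.\<close>
    have L': "exp (L a) = a" if "(k, a) \<in> set n_as" for k a
    proof (rule L)
      have "k \<noteq> 0" using pos that by force
      then show "a \<noteq> 0" using order[OF that] Q0(2) by (metis le_zero_eq order_0I)
    qed
    let ?b = "\<lambda>i. \<Sum>j = 1..p. C $$ (i - 1, j - 1) * f j z"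
    have "mat_sum n (\<lambda>i. ?b i \<cdot>\<^sub>m (mat_inv A ^\<^sub>m i)) {1..p} =
        fun_mat (\<lambda>a. \<Sum>i = 1..p. fps_const (?b i) * cpow_fps L a (- of_nat i))"
      using mat_inv_power_eq_fun_mat[OF A(2) L'] by (simp only: fun_mat_lincomb)
    also have "\<dots> = fun_mat (\<lambda>a. cpow_fps L a z)"
      unfolding fun_mat_eq_iff
    proof (intro ballI, clarify)
      fix k a d assume "(k, a) \<in> set n_as" "d < k"
      then have "d < order a Q" using order by fastforce
      then obtain l where l: "l < p" "\<And>z. f (l + 1) z = cpow_fps L a z $ d" using row by blast
      have "(\<Sum>i = 1..p. fps_const (?b i) * cpow_fps L a (- of_nat i)) $ d =
            (\<Sum>i = 1..p. ?b i * f (l + 1) (- of_nat i))"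
        by (simp add: fps_sum_nth l(2)[symmetric] del: cpow_fps_nth)
      also have "\<dots> = cpow_fps L a z $ d"
        using interpolation[of "l + 1" z] l(1) by (simp add: l(2)[symmetric] del: cpow_fps_nth)
      finally show "(\<Sum>i = 1..p. fps_const (?b i) * cpow_fps L a (- of_nat i)) $ d = cpow_fps L a z $ d" .
    qed
    finally show "M * jordan_matrix_cpow L n_as z * M' =
        mat_sum n (\<lambda>i. ?b i \<cdot>\<^sub>m (mat_inv A ^\<^sub>m i)) {1..p}"
      by (simp add: fun_mat_def jordan_matrix_cpow_eq_jordan_fun)
  qed
  with B_inv show ?thesis by (simp add: C_def)
qed

end
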